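(* For every integer $d\ge 2$, $$\operatorname{aff}_{\mathbb{Z}}\big(\mathcal{F}(\mathcal{P}^d_s)\big)=\mathrm{DS}_d\cap\mathbb{Z}^d,$$ where $\mathcal{F}(\mathcal{P}^d_s)\subset\mathbb{Z}^d$ is the set of $f$-vectors of all simplicial $d$-dimensional convex polytopes and $\mathrm{DS}_d:=\operatorname{aff}_{\mathbb{R}}(\mathcal{F}(\mathcal{P}^d_s))\subset\mathbb{R}^d$ is its real affine hull (the Dehn--Sommerville subspace).
   Context: A $d$-polytope is a $d$-dimensional convex polytope; it is simplicial if all its facets are simplices. Its $f$-vector is $f(P)=(f_0(P),\dots,f_{d-1}(P))\in\mathbb{Z}^d$, where $f_i(P)$ is the number of $i$-dimensional faces of $P$. For a set $S\subseteq\mathbb{Z}^d$, $\operatorname{aff}_{\mathbb{Z}}S$ is the set of all integral affine combinations $a_1v_1+\dots+a_nv_n$ with $n\ge1$, $v_1,\dots,v_n\in S$, $a_1,\dots,a_n\in\mathbb{Z}$ and $a_1+\dots+a_n=1$; $\operatorname{aff}_{\mathbb{R}}S$ is the usual real affine hull. *)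

theory Defs
  imports "HOL-Analysis.Analysis"
begin

definition face_number :: "nat \<Rightarrow> 'a::euclidean_space set \<Rightarrow> nat" where
  "face_number i P = card {F. F face_of P \<and> aff_dim F = int i}"

definition simplicial_polytope :: "nat \<Rightarrow> 'a::euclidean_space set \<Rightarrow> bool" where
  "simplicial_polytope d P \<longleftrightarrow>
     polytope P \<and> aff_dim P = int d \<and> (\<forall>F. F facet_of P \<longrightarrow> (\<exists>n. n simplex F))"

text \<open>
  Vectors in \<open>d\<close>-space have type \<open>real ^ 'n\<close> with \<open>d = CARD('n)\<close>. The index type is linearly
  ordered, and the index \<open>j\<close> stands for the number \<open>card {..<j}\<close> of indices below it; this
  enumerates the coordinates as \<open>0, \<dots>, d - 1\<close>. Integer vectors are regarded as real vectors
  with integer coordinates.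
\<close>

definition f_vector :: "'a::euclidean_space set \<Rightarrow> real ^ ('n::{finite,linorder})" where
  "f_vector P = (\<chi> j. real (face_number (card {..<j}) P))"

text \<open>The \<open>d\<close>-polytopes are taken full-dimensional in \<open>d\<close>-space, which gives every
  combinatorial type.\<close>

definition simplicial_f_vectors :: "(real ^ ('n::{finite,linorder})) set" where
  "simplicial_f_vectors =
     {f_vector P | P :: (real ^ ('n::{finite,linorder})) set. simplicial_polytope CARD('n) P}"

definition dehn_sommerville :: "(real ^ ('n::{finite,linorder})) set" where
  "dehn_sommerville = affine hull simplicial_f_vectors"

definition integer_points :: "(real ^ 'n) set" where
  "integer_points = {x. \<forall>j. x $ j \<in> \<int>}"

definition int_affine_hull :: "'a::real_vector set \<Rightarrow> 'a set" where
  "int_affine_hull S =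
     {(\<Sum>i<n. of_int (a i) *\<^sub>R v i) | (n::nat) (a :: nat \<Rightarrow> int) v.
        n \<ge> 1 \<and> (\<forall>i<n. v i \<in> S) \<and> (\<Sum>i<n. a i) = 1}"

end

(* Counting faces of a simplicial polytope through the facet in which a generic vector c is positive
   off the face writes the f-vector as the image of the h-vector (facets by number of negative
   coordinates of c) under a unitriangular integer matrix. Replacing c by -c reverses h, and h does
   not depend on c, so h is symmetric; hence on the real affine hull the coordinates f_0, ..., f_{m-1},
   m = floor(d/2), determine the whole vector. The cyclic polytopes with n vertices have
   f_{j-1} = (n choose j) for j <= m, and by unimodularity of these binomials (n = d+1, ..., d+m+1) they
   realize every integer choice of f_0, ..., f_{m-1} by an integral affine combination. *)

theory Submission
  imports Defs "HOL-Computational_Algebra.Polynomial"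
begin

section \<open>The complete simplicial fan of a polytope and its h-numbers\<close>

text \<open>The counting is the polar form of a familiar argument. With 0 inside P, a facet F is a
  vertex of the polar simple polytope and c is a generic linear objective on it. A coordinate of c
  in the basis F is negative exactly when c increases along the corresponding edge at that vertex.
  The polar face dual to G has a unique vertex maximizing c, and this is the facet assigned to G.
  Working with the cones over the facets avoids constructing the polar: it suffices that the cones
  cover the space and that every facet has a supporting functional. The dimension of the real affine
  hull is never computed. It is enough that the hull lies in the affine space of vectors that come
  from a symmetric real h with h_0 = 1, where the first m coordinates are injective. The empty face
  (j = 0) enters at both ends. It gives h_0 = 1, which starts the triangular recovery of h, and it
  turns into the condition that the integer coefficients sum to 1. Hence m coordinates call for m +
  1 polytopes.\<close>

lemma card_between_subsets:
  assumes "finite F" "N \<subseteq> F"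
  shows "card {G. N \<subseteq> G \<and> G \<subseteq> F \<and> card G = j}
       = (if card N \<le> j then (card F - card N) choose (j - card N) else 0)"
proof (cases "card N \<le> j")
  case True
  have "bij_betw (\<lambda>G. G - N) {G. N \<subseteq> G \<and> G \<subseteq> F \<and> card G = j} {H. H \<subseteq> F - N \<and> card H = j - card N}"
  proof (rule bij_betw_byWitness[where f' = "\<lambda>H. H \<union> N"])
    show "(\<lambda>H. H \<union> N) ` {H. H \<subseteq> F - N \<and> card H = j - card N} \<subseteq> {G. N \<subseteq> G \<and> G \<subseteq> F \<and> card G = j}"
    proof clarify
      fix H assume H: "H \<subseteq> F - N" "card H = j - card N"
      have "card (H \<union> N) = card H + card N"
        using H assms by (intro card_Un_disjoint) (auto intro: finite_subset)
      with H True assms show "N \<subseteq> H \<union> N \<and> H \<union> N \<subseteq> F \<and> card (H \<union> N) = j" by auto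
    qed
  qed (use assms in \<open>auto intro!: card_Diff_subset intro: finite_subset\<close>)
  then have "card {G. N \<subseteq> G \<and> G \<subseteq> F \<and> card G = j} = card {H. H \<subseteq> F - N \<and> card H = j - card N}"
    by (rule bij_betw_same_card)
  also have "\<dots> = card (F - N) choose (j - card N)"
    using assms by (intro n_subsets) auto
  finally show ?thesis using True assms by (simp add: card_Diff_subset finite_subset)
next
  case False
  moreover have "card N \<le> card G" if "N \<subseteq> G" "G \<subseteq> F" for G
    using that assms by (meson card_mono finite_subset)
  ultimately have "{G. N \<subseteq> G \<and> G \<subseteq> F \<and> card G = j} = {}" by auto
  then show ?thesis using False by (metis card.empty)
qed

text \<open>The diagonal coefficients are \<open>(d - k) choose 0 = 1\<close>, so h can be read off
  from the sums one index at a time. This gives both the independence of h from the generic vector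
  and the recovery of the lower half of h from the lower half of f.\<close>

lemma binomial_triangular_cancel:
  fixes h h' :: "nat \<Rightarrow> real"
  assumes "\<And>j. j \<le> n \<Longrightarrow> (\<Sum>k\<le>j. h k * real ((d - k) choose (j - k)))
                          = (\<Sum>k\<le>j. h' k * real ((d - k) choose (j - k)))"
    and "j \<le> n"
  shows "h j = h' j"
  using assms(2)
proof (induction j rule: less_induct)
  case (less j)
  have split: "(\<Sum>k\<le>j. g k * real ((d - k) choose (j - k)))
             = g j + (\<Sum>k<j. g k * real ((d - k) choose (j - k)))" for g :: "nat \<Rightarrow> real"
    by (simp flip: lessThan_Suc_atMost)
  have "(\<Sum>k<j. h k * real ((d - k) choose (j - k))) = (\<Sum>k<j. h' k * real ((d - k) choose (j - k)))"
    using less by (intro sum.cong) auto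
  with assms(1)[OF less.prems] show ?case by (simp add: split)
qed

text \<open>A facet is represented by its vertex set, which is a basis of the space. The vector a in
  \<open>facet_support\<close> is the polar vertex of the facet. That the cones meet only along
  common faces is not assumed; it follows from these functionals in
  \<open>positive_combination_in_cone\<close>.\<close>

locale simplicial_fan =
  fixes V :: "'a::euclidean_space set" and \<Phi> :: "'a set set"
  assumes finite_V: "finite V"
    and facet_subset: "F \<in> \<Phi> \<Longrightarrow> F \<subseteq> V"
    and facet_independent: "F \<in> \<Phi> \<Longrightarrow> independent F"
    and facet_card: "F \<in> \<Phi> \<Longrightarrow> card F = DIM('a)"
    and facet_support: "F \<in> \<Phi> \<Longrightarrow> \<exists>a. \<forall>v\<in>V. a \<bullet> v \<le> 1 \<and> (a \<bullet> v = 1 \<longleftrightarrow> v \<in> F)"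
    and cones_cover: "\<exists>F\<in>\<Phi>. \<forall>v\<in>F. 0 \<le> representation F y v"
begin

lemma finite_\<Phi>: "finite \<Phi>"
  using finite_V facet_subset by (intro finite_subset[of \<Phi> "Pow V"]) auto

lemma finite_facet: "F \<in> \<Phi> \<Longrightarrow> finite F"
  using finite_V facet_subset finite_subset by blast

lemma span_facet: "F \<in> \<Phi> \<Longrightarrow> y \<in> span F"
  using card_ge_dim_independent[of F UNIV] facet_independent facet_card by auto

lemma sum_facet_representation: "F \<in> \<Phi> \<Longrightarrow> (\<Sum>v\<in>F. representation F y v *\<^sub>R v) = y"
  using sum_representation_eq[of F y F] facet_independent span_facet finite_facet by auto

lemma representation_facet_add:
  "F \<in> \<Phi> \<Longrightarrow> representation F (x + t *\<^sub>R y) v = representation F x v + t * representation F y v"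
  by (simp add: representation_add representation_scale facet_independent span_facet)

lemma representation_facet_sum:
  assumes "F \<in> \<Phi>" "G \<subseteq> F"
  shows "representation F (\<Sum>G) v = (if v \<in> G then 1 else 0)"
proof -
  have fin: "finite G" using assms finite_facet finite_subset by blast
  have "representation F (\<Sum>G) v = (\<Sum>w\<in>G. representation F w v)"
    using assms by (simp add: representation_sum facet_independent span_facet)
  also have "\<dots> = (\<Sum>w\<in>G. if v = w then 1 else 0)"
    using assms by (intro sum.cong) (auto simp: representation_basis facet_independent)
  finally show ?thesis using fin by simp
qed

text \<open>Evaluate the supporting functionals a of F and b of F' at y. Since a is 1 on G and at
  most 1 on F', the weights of y in F' sum to at least those in G; the former sum is
  \<open>b \<bullet> y\<close>. As b is at most 1 on G and the weights there are positive, b must be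
  1 on all of G, which puts G inside F'.\<close>

lemma positive_combination_in_cone:
  assumes F: "F \<in> \<Phi>" "F' \<in> \<Phi>" "G \<subseteq> F"
    and pos: "\<And>v. v \<in> G \<Longrightarrow> 0 < \<mu> v" and y: "y = (\<Sum>v\<in>G. \<mu> v *\<^sub>R v)"
    and cone: "\<And>v. v \<in> F' \<Longrightarrow> 0 \<le> representation F' y v"
  shows "G \<subseteq> F'"
proof -
  let ?r = "representation F' y"
  obtain a where a: "\<And>v. v \<in> V \<Longrightarrow> a \<bullet> v \<le> 1" "\<And>v. v \<in> V \<Longrightarrow> a \<bullet> v = 1 \<longleftrightarrow> v \<in> F"
    using facet_support[OF F(1)] by blast
  obtain b where b: "\<And>v. v \<in> V \<Longrightarrow> b \<bullet> v \<le> 1" "\<And>v. v \<in> V \<Longrightarrow> b \<bullet> v = 1 \<longleftrightarrow> v \<in> F'"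
    using facet_support[OF F(2)] by blast
  have fin: "finite G" using F finite_facet finite_subset by blast
  have sub: "F \<subseteq> V" "F' \<subseteq> V" using F facet_subset by auto
  have y': "y = (\<Sum>v\<in>F'. ?r v *\<^sub>R v)" using sum_facet_representation F by simp
  have "(\<Sum>v\<in>G. \<mu> v) = (\<Sum>v\<in>G. \<mu> v * (a \<bullet> v))"
    using a(2) F(3) sub by (intro sum.cong) auto
  also have "\<dots> = a \<bullet> y" by (simp add: y inner_sum_right)
  also have "\<dots> = (\<Sum>v\<in>F'. ?r v * (a \<bullet> v))" by (subst y') (simp add: inner_sum_right)
  also have "\<dots> \<le> (\<Sum>v\<in>F'. ?r v * 1)"
    using cone a(1) sub by (intro sum_mono mult_left_mono) auto
  also have "\<dots> = (\<Sum>v\<in>F'. ?r v * (b \<bullet> v))"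
    using b(2) sub by (intro sum.cong) auto
  also have "\<dots> = b \<bullet> y" by (subst (2) y') (simp add: inner_sum_right)
  also have "\<dots> = (\<Sum>v\<in>G. \<mu> v * (b \<bullet> v))" by (simp add: y inner_sum_right)
  finally have le: "(\<Sum>v\<in>G. \<mu> v) \<le> (\<Sum>v\<in>G. \<mu> v * (b \<bullet> v))" .
  have nn: "0 \<le> \<mu> v * (1 - b \<bullet> v)" if "v \<in> G" for v
    using that pos[of v] b(1)[of v] F(3) sub by (intro mult_nonneg_nonneg) auto
  have "(\<Sum>v\<in>G. \<mu> v * (1 - b \<bullet> v)) \<le> 0"
    using le by (simp add: right_diff_distrib sum_subtractf)
  then have "(\<Sum>v\<in>G. \<mu> v * (1 - b \<bullet> v)) = 0"
    using nn by (intro antisym sum_nonneg) auto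
  then have "\<forall>v\<in>G. \<mu> v * (1 - b \<bullet> v) = 0"
    using sum_nonneg_eq_0_iff[OF fin nn] by auto
  then have "\<forall>v\<in>G. b \<bullet> v = 1" using pos by fastforce
  then show ?thesis using b(2) F(3) sub by auto
qed

section \<open>Generic vectors and h-numbers\<close>

definition generic :: "'a \<Rightarrow> bool" where
  "generic c \<longleftrightarrow> (\<forall>F\<in>\<Phi>. \<forall>v\<in>F. representation F c v \<noteq> 0)"

definition neg_part :: "'a \<Rightarrow> 'a set \<Rightarrow> 'a set" where
  "neg_part c F = {v \<in> F. representation F c v < 0}"

text \<open>A vector with a vanishing coordinate lies in one of finitely many proper subspaces, and
  these form a null set.\<close>

lemma ex_generic: "\<exists>c. generic c"
proof -
  let ?bad = "\<Union>F\<in>\<Phi>. \<Union>v\<in>F. span (F - {v})"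
  have "negligible (span (F - {v}))" if "F \<in> \<Phi>" "v \<in> F" for F v
  proof (rule negligible_lowdim)
    have "dim (span (F - {v})) \<le> card (F - {v})"
      using that finite_facet by (metis dim_span dim_le_card' finite_Diff)
    also have "\<dots> < card F" using that finite_facet by (intro psubset_card_mono) auto
    finally show "dim (span (F - {v})) < DIM('a)" using facet_card that by simp
  qed
  then have "negligible ?bad"
    using finite_\<Phi> finite_facet by (intro negligible_Union finite_imageI) auto
  then have "?bad \<noteq> UNIV" using non_negligible_UNIV by metis
  then obtain c where c: "c \<notin> ?bad" by blast
  have "representation F c v \<noteq> 0" if "F \<in> \<Phi>" "v \<in> F" for F v
  proof
    assume 0: "representation F c v = 0"
    have "c = (\<Sum>w\<in>F. representation F c w *\<^sub>R w)" using sum_facet_representation that by simp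
    also have "\<dots> = (\<Sum>w\<in>F - {v}. representation F c w *\<^sub>R w)"
      using 0 that finite_facet by (subst sum.remove[of F v]) auto
    also have "\<dots> \<in> span (F - {v})" by (intro span_sum span_scale span_base)
    finally show False using c that by auto
  qed
  then show ?thesis by (auto simp: generic_def)
qed

lemma generic_uminus: "generic c \<Longrightarrow> generic (- c)"
  by (simp add: generic_def representation_neg facet_independent span_facet)

lemma ex_large_scaling:
  fixes g :: "'a \<Rightarrow> real"
  assumes "finite F"
  shows "\<exists>t>0. \<forall>v\<in>F. 0 < g v + t"
proof (intro exI conjI ballI)
  show "0 < 1 + (\<Sum>v\<in>F. \<bar>g v\<bar>)" by (smt (verit) sum_nonneg abs_ge_zero)
  fix v assume "v \<in> F"
  then have "\<bar>g v\<bar> \<le> (\<Sum>v\<in>F. \<bar>g v\<bar>)" using assms by (intro member_le_sum) auto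
  then show "0 < g v + (1 + (\<Sum>v\<in>F. \<bar>g v\<bar>))" by linarith
qed

text \<open>Far along the ray from \<open>c\<close> in direction \<open>\<Sum>G\<close>, the cone containing the ray is the
  unique one that contains \<open>G\<close> and in which \<open>c\<close> is positive outside \<open>G\<close>.\<close>

lemma unique_facet:
  assumes gen: "generic c" and G: "F0 \<in> \<Phi>" "G \<subseteq> F0"
  shows "\<exists>!F. F \<in> \<Phi> \<and> neg_part c F \<subseteq> G \<and> G \<subseteq> F"
proof (rule ex_ex1I)
  have "\<forall>n::nat. \<exists>F\<in>\<Phi>. \<forall>v\<in>F. 0 \<le> representation F (c + real n *\<^sub>R \<Sum>G) v"
    using cones_cover by blast
  then obtain \<phi> where \<phi>: "\<And>n::nat. \<phi> n \<in> \<Phi>"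
      "\<And>n v. v \<in> \<phi> n \<Longrightarrow> 0 \<le> representation (\<phi> n) (c + real n *\<^sub>R \<Sum>G) v"
    by metis
  \<comment> \<open>By pigeonhole one facet F serves infinitely many n, so its inequalities hold for
    arbitrarily large n.\<close>
  have "finite (range \<phi>)" using finite_\<Phi> \<phi>(1) by (auto intro: finite_subset)
  then obtain n0 where inf: "infinite {n. \<phi> n = \<phi> n0}"
    using pigeonhole_infinite[of "UNIV :: nat set" \<phi>] by auto
  define F where "F = \<phi> n0"
  have F: "F \<in> \<Phi>" using \<phi>(1) F_def by simp
  have large: "\<exists>n\<ge>N. \<forall>v\<in>F. 0 \<le> representation F c v + real n * representation F (\<Sum>G) v" for N
  proof -
    obtain n where "n \<ge> N" "\<phi> n = F"
      using inf unfolding infinite_nat_iff_unbounded_le F_def by auto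
    then show ?thesis using \<phi>(2)[of _ n] F by (auto simp: representation_facet_add)
  qed
  \<comment> \<open>A negative coordinate of the direction would eventually outweigh the fixed
    coordinate of c.\<close>
  have "0 \<le> representation F (\<Sum>G) v" if v: "v \<in> F" for v
  proof (rule ccontr)
    assume neg: "\<not> ?thesis"
    obtain N :: nat where N: "real N * (- representation F (\<Sum>G) v) > representation F c v"
      using reals_Archimedean3[of "- representation F (\<Sum>G) v"] neg by auto
    obtain n where n: "n \<ge> N" "0 \<le> representation F c v + real n * representation F (\<Sum>G) v"
      using large[of N] v by auto
    have "real n * representation F (\<Sum>G) v \<le> real N * representation F (\<Sum>G) v"
      using n neg by (intro mult_right_mono_neg) auto
    then show False using N n by auto
  qed
  then have GF: "G \<subseteq> F"
    using positive_combination_in_cone[of F0 F G "\<lambda>_. 1" "\<Sum>G"] F G by auto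
  \<comment> \<open>Off G the direction has coordinate 0 in F, so the coordinate of c is constant
    along the ray.\<close>
  have "0 \<le> representation F c v" if "v \<in> F - G" for v
    using large[of 0] that F GF by (auto simp: representation_facet_sum)
  then have "neg_part c F \<subseteq> G" unfolding neg_part_def by force
  then show "\<exists>F. F \<in> \<Phi> \<and> neg_part c F \<subseteq> G \<and> G \<subseteq> F" using F GF by blast
next
  \<comment> \<open>A point y far along the ray has positive coordinates at all of F and also lies
    in the cone of F'. The previous lemma, applied with F itself in place of G, gives the inclusion;
    the roles are then exchanged.\<close>
  have sub: "F \<subseteq> F'" if F: "F \<in> \<Phi> \<and> neg_part c F \<subseteq> G \<and> G \<subseteq> F"
      and F': "F' \<in> \<Phi> \<and> neg_part c F' \<subseteq> G \<and> G \<subseteq> F'" for F F'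
  proof -
    obtain s where s: "s > 0" "\<forall>v\<in>F. 0 < representation F c v + s"
      using ex_large_scaling finite_facet F by blast
    obtain t where t: "t > 0" "\<forall>v\<in>F'. 0 < representation F' c v + t"
      using ex_large_scaling finite_facet F' by blast
    define y where "y = c + max s t *\<^sub>R \<Sum>G"
    have pos: "0 < representation H c v" if "H \<in> \<Phi>" "neg_part c H \<subseteq> G" "v \<in> H - G" for H v
      using that gen unfolding generic_def neg_part_def by force
    have "0 < representation F y v" if "v \<in> F" for v
      using that F s pos[of F v] unfolding y_def
      by (auto simp: representation_facet_add representation_facet_sum max_def intro: add_strict_increasing2)
    moreover have "0 \<le> representation F' y v" if "v \<in> F'" for v
      using that F' t pos[of F' v] unfolding y_def
      by (force simp: representation_facet_add representation_facet_sum max_def)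
    ultimately show "F \<subseteq> F'"
      using positive_combination_in_cone[of F F' F "representation F y" y] F F'
      by (auto simp: sum_facet_representation)
  qed
  fix F F'
  assume "F \<in> \<Phi> \<and> neg_part c F \<subseteq> G \<and> G \<subseteq> F" "F' \<in> \<Phi> \<and> neg_part c F' \<subseteq> G \<and> G \<subseteq> F'"
  then show "F = F'" using sub[of F F'] sub[of F' F] by auto
qed

definition h_number :: "'a \<Rightarrow> nat \<Rightarrow> nat" where
  "h_number c k = card {F \<in> \<Phi>. card (neg_part c F) = k}"

text \<open>By \<open>unique_facet\<close> the Boolean intervals from \<open>neg_part c F\<close> to
  F partition the faces. An interval whose bottom has k elements contains
  \<open>(d - k) choose (j - k)\<close> sets of size j, where d is the dimension.\<close>

lemma card_faces_h_number:
  assumes "generic c" "j \<le> DIM('a)"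
  shows "card {G. card G = j \<and> (\<exists>F\<in>\<Phi>. G \<subseteq> F)}
       = (\<Sum>k\<le>j. h_number c k * ((DIM('a) - k) choose (j - k)))"
proof -
  let ?A = "\<lambda>F. {G. neg_part c F \<subseteq> G \<and> G \<subseteq> F \<and> card G = j}"
  let ?w = "\<lambda>k. if k \<le> j then (DIM('a) - k) choose (j - k) else 0"
  have neg: "neg_part c F \<subseteq> F" for F by (auto simp: neg_part_def)
  have "{G. card G = j \<and> (\<exists>F\<in>\<Phi>. G \<subseteq> F)} = (\<Union>F\<in>\<Phi>. ?A F)"
  proof (intro set_eqI iffI)
    fix G assume "G \<in> {G. card G = j \<and> (\<exists>F\<in>\<Phi>. G \<subseteq> F)}"
    then obtain F0 where "F0 \<in> \<Phi>" "G \<subseteq> F0" "card G = j" by auto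
    then show "G \<in> (\<Union>F\<in>\<Phi>. ?A F)"
      using unique_facet[OF assms(1), of F0 G] by auto
  qed auto
  also have "card \<dots> = (\<Sum>F\<in>\<Phi>. card (?A F))"
  proof (intro card_UN_disjoint ballI impI)
    fix F F' assume F: "F \<in> \<Phi>" "F' \<in> \<Phi>" "F \<noteq> F'"
    show "?A F \<inter> ?A F' = {}"
    proof (rule ccontr)
      assume "?A F \<inter> ?A F' \<noteq> {}"
      then obtain G where "neg_part c F \<subseteq> G" "G \<subseteq> F" "neg_part c F' \<subseteq> G" "G \<subseteq> F'" by auto
      then show False using unique_facet[OF assms(1), of F G] F by auto
    qed
  qed (use finite_\<Phi> finite_facet in auto)
  also have "\<dots> = (\<Sum>F\<in>\<Phi>. ?w (card (neg_part c F)))"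
    using neg finite_facet facet_card by (intro sum.cong) (simp_all add: card_between_subsets)
  also have "\<dots> = (\<Sum>k\<le>DIM('a). \<Sum>F\<in>{F \<in> \<Phi>. card (neg_part c F) = k}. ?w (card (neg_part c F)))"
    using finite_\<Phi> neg facet_card card_mono[OF finite_facet neg]
    by (intro sum.group[symmetric]) auto
  also have "\<dots> = (\<Sum>k\<le>DIM('a). h_number c k * ?w k)"
    by (intro sum.cong) (auto simp: h_number_def)
  also have "\<dots> = (\<Sum>k\<le>j. h_number c k * ((DIM('a) - k) choose (j - k)))"
    using assms(2) by (intro sum.mono_neutral_cong_right) auto
  finally show ?thesis .
qed

lemma h_number_uminus:
  assumes "generic c" "k \<le> DIM('a)"
  shows "h_number (- c) k = h_number c (DIM('a) - k)"
proof -
  have "card (neg_part (- c) F) = DIM('a) - card (neg_part c F)" "card (neg_part c F) \<le> DIM('a)"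
    if "F \<in> \<Phi>" for F
  proof -
    have "neg_part (- c) F = F - neg_part c F"
      using assms(1) that unfolding neg_part_def generic_def
      by (auto simp: representation_neg facet_independent span_facet) (meson linorder_cases)
    moreover have sub: "neg_part c F \<subseteq> F" by (auto simp: neg_part_def)
    ultimately show "card (neg_part (- c) F) = DIM('a) - card (neg_part c F)"
      using that by (simp add: card_Diff_subset finite_subset[OF sub] finite_facet facet_card)
    show "card (neg_part c F) \<le> DIM('a)"
      using card_mono[OF finite_facet[OF that] sub] facet_card[OF that] by simp
  qed
  then have "{F \<in> \<Phi>. card (neg_part (- c) F) = k} = {F \<in> \<Phi>. card (neg_part c F) = DIM('a) - k}"
    using assms(2) by fastforce
  then show ?thesis by (simp add: h_number_def)
qed

theorem dehn_sommerville_relations: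
  obtains h :: "nat \<Rightarrow> nat" where "h 0 = 1" "\<And>k. k \<le> DIM('a) \<Longrightarrow> h (DIM('a) - k) = h k"
    "\<And>j. j \<le> DIM('a) \<Longrightarrow> card {G. card G = j \<and> (\<exists>F\<in>\<Phi>. G \<subseteq> F)}
                          = (\<Sum>k\<le>j. h k * ((DIM('a) - k) choose (j - k)))"
proof -
  obtain c where c: "generic c" using ex_generic by blast
  show thesis
  proof (rule that[of "h_number c"])
    show f: "card {G. card G = j \<and> (\<exists>F\<in>\<Phi>. G \<subseteq> F)}
           = (\<Sum>k\<le>j. h_number c k * ((DIM('a) - k) choose (j - k)))" if "j \<le> DIM('a)" for j
      using card_faces_h_number[OF c that] .
    \<comment> \<open>Infinite sets also have \<open>card\<close> 0; being contained in a finite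
      facet rules them out.\<close>
    have "{G. card G = 0 \<and> (\<exists>F\<in>\<Phi>. G \<subseteq> F)} = {{}}"
      using cones_cover finite_facet finite_subset by (fastforce simp: card_eq_0_iff)
    then show "h_number c 0 = 1" using f[of 0] by simp
    fix k assume k: "k \<le> DIM('a)"
    \<comment> \<open>The face counts do not mention c, so c and its negative have h-numbers with
      the same triangular sums.\<close>
    have "real (h_number c k) = real (h_number (- c) k)"
    proof (rule binomial_triangular_cancel[where h = "\<lambda>k. real (h_number c k)"
            and h' = "\<lambda>k. real (h_number (- c) k)" and n = "DIM('a)" and d = "DIM('a)"])
      fix j assume "j \<le> DIM('a)"
      then have "(\<Sum>k\<le>j. h_number c k * ((DIM('a) - k) choose (j - k)))
               = (\<Sum>k\<le>j. h_number (- c) k * ((DIM('a) - k) choose (j - k)))"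
        using card_faces_h_number[OF c] card_faces_h_number[OF generic_uminus[OF c]] by simp
      from arg_cong[OF this, of real]
      show "(\<Sum>k\<le>j. real (h_number c k) * real ((DIM('a) - k) choose (j - k)))
               = (\<Sum>k\<le>j. real (h_number (- c) k) * real ((DIM('a) - k) choose (j - k)))"
        by (simp only: of_nat_mult of_nat_sum)
    qed (use k in auto)
    then show "h_number c (DIM('a) - k) = h_number c k" using h_number_uminus[OF c k] by simp
  qed
qed

end

section \<open>Simplicial polytopes\<close>

lemma representation_sum_scaleR:
  assumes "independent B" "finite B" "w \<in> B"
  shows "representation B (\<Sum>v\<in>B. u v *\<^sub>R v) w = u w"
proof -
  have "representation B (\<Sum>v\<in>B. u v *\<^sub>R v) w = (\<Sum>v\<in>B. u v * representation B v w)"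
    using assms(1) by (subst representation_sum) (auto simp: representation_scale span_base span_scale)
  also have "\<dots> = (\<Sum>v\<in>B. if w = v then u v else 0)"
    using assms(1) by (intro sum.cong) (auto simp: representation_basis)
  finally show ?thesis using assms by simp
qed

lemma affine_independent_imp_independent:
  fixes C :: "'a::euclidean_space set"
  assumes "\<not> affine_dependent C" "0 \<notin> affine hull C"
  shows "independent C"
proof -
  have "\<not> affine_dependent (insert 0 C)"
    using assms by (rule affine_independent_insert)
  moreover have "0 \<notin> C" using assms(2) hull_inc by metis
  ultimately have "\<not> dependent {x - 0 |x. x \<in> C}" using dependent_imp_affine_dependent[of 0 C] by blast
  then show ?thesis by simp
qed

section \<open>The fan and the face numbers of a simplicial polytope\<close>

definition vertices :: "'a::euclidean_space set \<Rightarrow> 'a set" where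
  "vertices P = {v. v extreme_point_of P}"

definition facet_vertex_sets :: "'a::euclidean_space set \<Rightarrow> 'a set set" where
  "facet_vertex_sets P = {vertices F | F. F facet_of P}"

lemma vertices_face: "F face_of P \<Longrightarrow> vertices F = vertices P \<inter> F"
  using extreme_point_of_face by (auto simp: vertices_def)

lemma vertices_convex_hull: "\<not> affine_dependent C \<Longrightarrow> vertices (convex hull C) = C"
  by (auto simp: vertices_def extreme_point_of_convex_hull_affine_independent)

lemma simplicial_polytope_facet:
  fixes P :: "'a::euclidean_space set"
  assumes "simplicial_polytope d P" "F facet_of P"
  shows "\<not> affine_dependent (vertices F)" "card (vertices F) = d" "F = convex hull (vertices F)"
proof -
  obtain C where C: "\<not> affine_dependent C" "F = convex hull C"
    using assms unfolding simplicial_polytope_def simplex_def by blast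
  then have eq: "vertices F = C" by (simp add: vertices_convex_hull)
  have "aff_dim F = int d - 1" using assms by (auto simp: simplicial_polytope_def facet_of_def)
  then show "card (vertices F) = d"
    using aff_dim_affine_independent[OF C(1)] C(2) eq by (simp add: aff_dim_convex_hull)
  show "\<not> affine_dependent (vertices F)" "F = convex hull (vertices F)" using C eq by auto
qed

lemma proper_face_supporting_hyperplane:
  fixes P :: "'a::euclidean_space set"
  assumes "polyhedron P" "F face_of P" "F \<noteq> P" "F \<noteq> {}"
  obtains a b where "a \<noteq> 0" "P \<subseteq> {x. a \<bullet> x \<le> b}" "F = P \<inter> {x. a \<bullet> x = b}"
proof -
  have "F exposed_face_of P" using assms exposed_face_of_polyhedron by blast
  then obtain a b where ab: "P \<subseteq> {x. a \<bullet> x \<le> b}" "F = P \<inter> {x. a \<bullet> x = b}"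
    unfolding exposed_face_of_def by blast
  \<comment> \<open>For \<open>a = 0\<close> the hyperplane would be everything or nothing, and the
    face would be P or empty.\<close>
  then have "a \<noteq> 0" using assms(3,4) by (cases "b = 0") auto
  then show thesis using ab by (rule that)
qed

text \<open>An interior origin makes the offset of the supporting hyperplane positive, so it can be
  scaled to 1.\<close>

lemma facet_normalized_functional:
  fixes P :: "'a::euclidean_space set"
  assumes P: "polytope P" "0 \<in> interior P" and F: "F facet_of P"
  shows "\<exists>a. \<forall>x\<in>P. a \<bullet> x \<le> 1 \<and> (a \<bullet> x = 1 \<longleftrightarrow> x \<in> F)"
proof -
  have "F face_of P" "F \<noteq> P" "F \<noteq> {}" using F by (auto simp: facet_of_def)
  then obtain a b where a0: "a \<noteq> 0" and ab: "P \<subseteq> {x. a \<bullet> x \<le> b}" "F = P \<inter> {x. a \<bullet> x = b}"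
    using proper_face_supporting_hyperplane[OF polytope_imp_polyhedron[OF P(1)]] by metis
  have "0 \<in> interior {x. a \<bullet> x \<le> b}" using ab(1) P(2) interior_mono by blast
  then have "b > 0" using a0 by simp
  then show ?thesis using ab by (intro exI[of _ "a /\<^sub>R b"]) (auto simp: field_simps)
qed

lemma independent_facet_vertices:
  fixes P :: "'a::euclidean_space set"
  assumes P: "simplicial_polytope d P" "0 \<in> interior P" and F: "F facet_of P"
  shows "independent (vertices F)"
proof -
  have "polytope P" using P by (simp add: simplicial_polytope_def)
  then obtain a where a: "\<forall>x\<in>P. a \<bullet> x = 1 \<longleftrightarrow> x \<in> F"
    using facet_normalized_functional[OF _ P(2) F] by blast
  have "vertices F \<subseteq> {x. a \<bullet> x = 1}"
    using a facet_of_imp_subset[OF F] by (auto simp: vertices_def extreme_point_of_def)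
  then have "affine hull (vertices F) \<subseteq> {x. a \<bullet> x = 1}" by (intro hull_minimal affine_hyperplane)
  then show ?thesis
    using simplicial_polytope_facet[OF P(1) F] by (intro affine_independent_imp_independent) auto
qed

text \<open>For the covering, the ray through y leaves P at a frontier point, which lies in some
  facet. The convex coordinates of that point, divided by the scaling t, are the cone coordinates of
  y.\<close>

lemma simplicial_fan_facets:
  fixes P :: "'a::euclidean_space set"
  assumes P: "simplicial_polytope DIM('a) P" and int: "0 \<in> interior P"
  shows "simplicial_fan (vertices P) (facet_vertex_sets P)"
proof -
  have poly: "polytope P" using P by (simp add: simplicial_polytope_def)
  have hed: "polyhedron P" using poly polytope_imp_polyhedron by blast
  note simp_facet = simplicial_polytope_facet[OF P]
  note indep = independent_facet_vertices[OF P int]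
  have cover: "\<exists>F\<in>facet_vertex_sets P. \<forall>v\<in>F. 0 \<le> representation F y v" if y: "y \<noteq> 0" for y
  proof -
    obtain t where t: "t > 0" "t *\<^sub>R y \<in> frontier P"
      using ray_to_frontier[OF polytope_imp_bounded[OF poly] int y] by auto
    have "frontier P = \<Union> {F. F facet_of P}"
      using rel_frontier_of_polyhedron[OF hed] rel_frontier_nonempty_interior[of P] int by auto
    then obtain F where F: "F facet_of P" "t *\<^sub>R y \<in> F" using t by auto
    have fin: "finite (vertices F)" using simp_facet(1)[OF F(1)] aff_independent_finite by blast
    have "t *\<^sub>R y \<in> convex hull (vertices F)" using F simp_facet(3)[OF F(1)] by simp
    then obtain u where u: "\<forall>v\<in>vertices F. 0 \<le> u v" "(\<Sum>v\<in>vertices F. u v *\<^sub>R v) = t *\<^sub>R y"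
      unfolding convex_hull_finite[OF fin] by auto
    have "y = inverse t *\<^sub>R (\<Sum>v\<in>vertices F. u v *\<^sub>R v)" using u(2) t by simp
    also have "\<dots> = (\<Sum>v\<in>vertices F. (inverse t * u v) *\<^sub>R v)" by (simp add: scaleR_right.sum)
    finally have "representation (vertices F) y v = inverse t * u v" if "v \<in> vertices F" for v
      using representation_sum_scaleR[OF indep[OF F(1)] fin that, of "\<lambda>v. inverse t * u v"] by simp
    then show ?thesis using u t F by (auto simp: facet_vertex_sets_def)
  qed
  show ?thesis
  proof
    show "finite (vertices P)"
      using finite_polyhedron_extreme_points[OF hed] by (simp add: vertices_def)
    fix G assume "G \<in> facet_vertex_sets P"
    then obtain F where F: "F facet_of P" "G = vertices F" by (auto simp: facet_vertex_sets_def)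
    have G: "G = vertices P \<inter> F" using F vertices_face facet_of_imp_face_of by blast
    have VP: "vertices P \<subseteq> P" by (auto simp: vertices_def extreme_point_of_def)
    show "G \<subseteq> vertices P" using G by simp
    show "card G = DIM('a)" "independent G" using simp_facet indep F by simp_all
    show "\<exists>a. \<forall>v\<in>vertices P. a \<bullet> v \<le> 1 \<and> (a \<bullet> v = 1 \<longleftrightarrow> v \<in> G)"
      using facet_normalized_functional[OF poly int F(1)] VP G by (metis IntE IntI subsetD)
  next
    fix y :: 'a
    show "\<exists>F\<in>facet_vertex_sets P. \<forall>v\<in>F. 0 \<le> representation F y v"
    proof (cases "y = 0")
      case True
      \<comment> \<open>Every cone contains 0, so it remains to exhibit a facet; covering a nonzero
        vector yields one.\<close>
      obtain b :: 'a where "b \<in> Basis" using nonempty_Basis by blast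
      then have "facet_vertex_sets P \<noteq> {}" using cover[of b] nonzero_Basis by auto
      then show ?thesis using True by (auto simp: representation_zero)
    qed (use cover in auto)
  qed
qed

text \<open>A proper face lies in a facet, and the faces of a simplex are the hulls of its vertex
  subsets. A face with j vertices has dimension \<open>j - 1\<close>.\<close>

lemma face_number_simplicial:
  fixes P :: "'a::euclidean_space set"
  assumes P: "simplicial_polytope d P" and j: "1 \<le> j" "j \<le> d"
  shows "face_number (j - 1) P = card {G. card G = j \<and> (\<exists>F\<in>facet_vertex_sets P. G \<subseteq> F)}"
proof -
  have poly: "polytope P" "aff_dim P = int d" using P by (simp_all add: simplicial_polytope_def)
  note simp_facet = simplicial_polytope_facet[OF P]
  have subface: "\<exists>F. F facet_of P \<and> G \<subseteq> vertices F \<and> \<not> affine_dependent G"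
    if "\<exists>F\<in>facet_vertex_sets P. G \<subseteq> F" for G
    using that simp_facet affine_dependent_subset unfolding facet_vertex_sets_def by blast
  have "bij_betw (\<lambda>G. convex hull G) {G. card G = j \<and> (\<exists>F\<in>facet_vertex_sets P. G \<subseteq> F)}
          {T. T face_of P \<and> aff_dim T = int (j - 1)}"
  proof (rule bij_betw_byWitness[where f' = vertices])
    show "\<forall>G\<in>{G. card G = j \<and> (\<exists>F\<in>facet_vertex_sets P. G \<subseteq> F)}. vertices (convex hull G) = G"
      using subface vertices_convex_hull by blast
    have *: "\<exists>F G. F facet_of P \<and> G \<subseteq> vertices F \<and> T = convex hull G \<and> vertices T = G \<and> card G = j"
      if T: "T face_of P" "aff_dim T = int (j - 1)" for T
    proof -
      \<comment> \<open>The dimension \<open>j - 1\<close> is nonnegative and below d.\<close>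
      have "T \<noteq> {}" "T \<noteq> P" using T poly j by auto
      then obtain F where F: "F facet_of P" "T \<subseteq> F"
        using face_of_polyhedron_subset_facet polytope_imp_polyhedron poly T by metis
      have "T face_of F"
        using face_of_subset[OF T(1) F(2)] facet_of_imp_subset[OF F(1)] by simp
      then obtain G where G: "G \<subseteq> vertices F" "T = convex hull G"
        using face_of_convex_hull_affine_independent[OF simp_facet(1)] simp_facet(3) F(1) by metis
      have "\<not> affine_dependent G" using G simp_facet(1) F affine_dependent_subset by blast
      then show ?thesis
        using F G T j vertices_convex_hull aff_dim_affine_independent[of G]
        by (intro exI[of _ F] exI[of _ G]) (auto simp: aff_dim_convex_hull)
    qed
    show "\<forall>T\<in>{T. T face_of P \<and> aff_dim T = int (j - 1)}. convex hull (vertices T) = T"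
      using * by blast
    show "vertices ` {T. T face_of P \<and> aff_dim T = int (j - 1)}
            \<subseteq> {G. card G = j \<and> (\<exists>F\<in>facet_vertex_sets P. G \<subseteq> F)}"
    proof (rule image_subsetI)
      fix T assume "T \<in> {T. T face_of P \<and> aff_dim T = int (j - 1)}"
      then have "T face_of P" "aff_dim T = int (j - 1)" by auto
      from *[OF this] obtain F G where "F facet_of P" "G \<subseteq> vertices F" "vertices T = G" "card G = j"
        by blast
      then show "vertices T \<in> {G. card G = j \<and> (\<exists>F\<in>facet_vertex_sets P. G \<subseteq> F)}"
        by (auto simp: facet_vertex_sets_def)
    qed
    show "(\<lambda>G. convex hull G) ` {G. card G = j \<and> (\<exists>F\<in>facet_vertex_sets P. G \<subseteq> F)}
            \<subseteq> {T. T face_of P \<and> aff_dim T = int (j - 1)}"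
    proof (rule image_subsetI)
      fix G assume "G \<in> {G. card G = j \<and> (\<exists>F\<in>facet_vertex_sets P. G \<subseteq> F)}"
      then have G: "card G = j" and ex: "\<exists>F\<in>facet_vertex_sets P. G \<subseteq> F" by auto
      obtain F where F: "F facet_of P" "G \<subseteq> vertices F" "\<not> affine_dependent G"
        using subface[OF ex] by auto
      have "convex hull G face_of F"
        using face_of_convex_hull_affine_independent[OF simp_facet(1)] simp_facet(3) F by metis
      then have "convex hull G face_of P"
        using F(1) face_of_trans facet_of_imp_face_of by blast
      then show "convex hull G \<in> {T. T face_of P \<and> aff_dim T = int (j - 1)}"
        using aff_dim_affine_independent[OF F(3)] G j by (simp add: aff_dim_convex_hull)
    qed
  qed
  from bij_betw_same_card[OF this] show ?thesis by (simp add: face_number_def)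
qed

lemma face_number_translation: "face_number i ((+) a ` P) = face_number i P"
proof -
  have "bij_betw ((`) ((+) a)) {F. F face_of P \<and> aff_dim F = int i}
          {F. F face_of (+) a ` P \<and> aff_dim F = int i}"
    by (rule bij_betw_byWitness[where f' = "(`) ((+) (- a))"])
       (auto simp: image_image aff_dim_translation_eq aff_dim_translation_eq_subtract face_of_translation_eq[of "- a" _ "(+) a ` P", symmetric]
             simp del: face_of_translation_eq
             intro: face_of_translation_eq[THEN iffD2])
  from bij_betw_same_card[OF this] show ?thesis by (simp add: face_number_def)
qed

lemma simplicial_polytope_translation:
  assumes "simplicial_polytope d P"
  shows "simplicial_polytope d ((+) a ` P)"
proof -
  have "\<exists>n. n simplex F" if F: "F facet_of (+) a ` P" for F
  proof -
    have eq: "F = (+) a ` (+) (- a) ` F" by (simp add: image_image)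
    have "(+) (- a) ` F facet_of P"
      using F face_of_translation_eq[of "- a" F "(+) a ` P"]
      by (auto simp: facet_of_def aff_dim_translation_eq aff_dim_translation_eq_subtract image_image)
    then obtain n where "n simplex (+) (- a) ` F"
      using assms unfolding simplicial_polytope_def by blast
    then obtain C where C: "\<not> affine_dependent C" "int (card C) = n + 1" "(+) (- a) ` F = convex hull C"
      unfolding simplex_def by blast
    then have "F = convex hull ((+) a ` C)" using eq by (metis convex_hull_translation)
    moreover have "card ((+) a ` C) = card C" by (intro card_image) simp
    moreover have "\<not> affine_dependent ((+) a ` C)"
      using C(1) affine_dependent_translation_eq by blast
    ultimately show ?thesis using C unfolding simplex_def by (intro exI[of _ n] exI[of _ "(+) a ` C"]) auto
  qed
  then show ?thesis
    using assms by (auto simp: simplicial_polytope_def polytope_translation_eq aff_dim_translation_eq)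
qed

theorem simplicial_polytope_h_vector:
  fixes P :: "'a::euclidean_space set"
  assumes "simplicial_polytope DIM('a) P"
  obtains h :: "nat \<Rightarrow> nat" where "h 0 = 1" "\<And>k. k \<le> DIM('a) \<Longrightarrow> h (DIM('a) - k) = h k"
    "\<And>j. 1 \<le> j \<Longrightarrow> j \<le> DIM('a) \<Longrightarrow>
        face_number (j - 1) P = (\<Sum>k\<le>j. h k * ((DIM('a) - k) choose (j - k)))"
proof -
  have "interior P \<noteq> {}"
    using assms interior_rel_interior_gen[of P] rel_interior_eq_empty[of P] polytope_imp_convex[of P]
    by (force simp: simplicial_polytope_def)
  then obtain p where p: "p \<in> interior P" by auto
  \<comment> \<open>The fan requires 0 in the interior; face numbers survive the
    translation.\<close>
  define Q where "Q = (+) (- p) ` P"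
  have Q: "simplicial_polytope DIM('a) Q"
    using assms simplicial_polytope_translation Q_def by blast
  have int: "0 \<in> interior Q"
    using p unfolding Q_def interior_translation by force
  interpret simplicial_fan "vertices Q" "facet_vertex_sets Q"
    by (rule simplicial_fan_facets[OF Q int])
  show thesis
  proof (rule dehn_sommerville_relations)
    fix h :: "nat \<Rightarrow> nat"
    assume h: "h 0 = 1" "\<And>k. k \<le> DIM('a) \<Longrightarrow> h (DIM('a) - k) = h k"
      "\<And>j. j \<le> DIM('a) \<Longrightarrow> card {G. card G = j \<and> (\<exists>F\<in>facet_vertex_sets Q. G \<subseteq> F)}
                            = (\<Sum>k\<le>j. h k * ((DIM('a) - k) choose (j - k)))"
    have "face_number (j - 1) P = (\<Sum>k\<le>j. h k * ((DIM('a) - k) choose (j - k)))"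
      if "1 \<le> j" "j \<le> DIM('a)" for j
      using h(3)[OF that(2)] face_number_simplicial[OF Q that] face_number_translation[of "j - 1" "- p" P]
      by (simp add: Q_def)
    with h(1,2) show thesis by (rule that)
  qed
qed

section \<open>Cyclic polytopes\<close>

abbreviation index :: "'n::{finite,linorder} \<Rightarrow> nat" where
  "index j \<equiv> card {..<j}"

lemma bij_betw_index: "bij_betw index (UNIV :: 'n::{finite,linorder} set) {..<CARD('n)}"
proof -
  have less: "index j < index k" if "j < k" for j k :: 'n
    using that by (intro psubset_card_mono) auto
  have inj: "inj (index :: 'n \<Rightarrow> nat)"
    by (rule linorder_injI) (use less in force)
  have "index j < CARD('n)" for j :: 'n
    by (intro psubset_card_mono) auto
  then have "range (index :: 'n \<Rightarrow> nat) \<subseteq> {..<CARD('n)}" by auto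
  then have "range (index :: 'n \<Rightarrow> nat) = {..<CARD('n)}"
    using card_image[OF inj] by (intro card_subset_eq) auto
  with inj show ?thesis by (simp add: bij_betw_def)
qed

lemma inj_index: "inj (index :: 'n::{finite,linorder} \<Rightarrow> nat)"
  using bij_betw_index by (rule bij_betw_imp_inj_on)

lemma index_less: "index (j :: 'n::{finite,linorder}) < CARD('n)"
  using bij_betwE[OF bij_betw_index] by blast

lemma ex_index: "i < CARD('n) \<Longrightarrow> \<exists>j :: 'n::{finite,linorder}. index j = i"
  using bij_betw_imp_surj_on[OF bij_betw_index] by (metis imageE lessThan_iff)

section \<open>The moment curve and its hyperplane sections\<close>

definition moment_curve :: "real \<Rightarrow> real ^ ('n::{finite,linorder})" where
  "moment_curve t = (\<chi> j. t ^ Suc (index j))"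

lemma inj_moment_curve: "inj (moment_curve :: real \<Rightarrow> real ^ ('n::{finite,linorder}))"
proof (rule injI)
  fix s t assume eq: "(moment_curve s :: real ^ ('n::{finite,linorder})) = moment_curve t"
  obtain j :: 'n where "index j = 0" using ex_index[where 'n = 'n, of 0] by auto
  then show "s = t" using arg_cong[OF eq, of "\<lambda>x. x $ j"] by (simp add: moment_curve_def)
qed

lemma inner_moment_curve:
  "a \<bullet> (moment_curve t :: real ^ ('n::{finite,linorder})) = (\<Sum>j\<in>UNIV. a $ j * t ^ Suc (index j))"
  by (simp add: inner_vec_def moment_curve_def)

text \<open>On the curve an affine functional becomes a polynomial in t of degree at most the
  dimension, and the parameters of intersection are its roots.\<close>

lemma finite_card_moment_curve_hyperplane:
  fixes a :: "real ^ ('n::{finite,linorder})"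
  assumes "a \<noteq> 0"
  shows "finite {t. a \<bullet> moment_curve t = b}" "card {t. a \<bullet> moment_curve t = b} \<le> CARD('n)"
proof -
  define p where "p = (\<Sum>j\<in>UNIV. monom (a $ j) (Suc (index j))) - [:b:]"
  obtain j where j: "a $ j \<noteq> 0" using assms by (auto simp: vec_eq_iff)
  \<comment> \<open>The offset b sits in the constant coefficient, so it cannot cancel the nonzero
    \<open>a $ j\<close>.\<close>
  have "coeff p (Suc (index j)) = (\<Sum>k\<in>UNIV. if k = j then a $ k else 0)"
    unfolding p_def by (auto simp: coeff_sum inj_eq[OF inj_index] intro!: sum.cong)
  then have p: "p \<noteq> 0" using j by auto
  have eq: "{t. a \<bullet> moment_curve t = b} = {t. poly p t = 0}"
    by (simp add: p_def inner_moment_curve poly_sum poly_monom)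
  have "degree p \<le> CARD('n)"
    unfolding p_def using index_less
    by (intro degree_diff_le degree_sum_le) (auto intro: order.trans[OF degree_monom_le] Suc_leI)
  then show "finite {t. a \<bullet> moment_curve t = b}" "card {t. a \<bullet> moment_curve t = b} \<le> CARD('n)"
    using poly_roots_finite[OF p] card_poly_roots_bound[OF p] eq by auto
qed

lemma card_moment_curve_hyperplane:
  fixes a :: "real ^ ('n::{finite,linorder})"
  assumes "a \<noteq> 0" "S \<subseteq> range moment_curve" "S \<subseteq> {x. a \<bullet> x = b}"
  shows "card S \<le> CARD('n)"
proof -
  let ?R = "{t. a \<bullet> moment_curve t = b}"
  have "S \<subseteq> moment_curve ` ?R" using assms(2,3) by auto
  then have "card S \<le> card (moment_curve ` ?R :: (real ^ ('n::{finite,linorder})) set)"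
    using finite_card_moment_curve_hyperplane[OF assms(1)] by (intro card_mono) auto
  also have "\<dots> \<le> card ?R"
    using finite_card_moment_curve_hyperplane[OF assms(1)] by (intro card_image_le) auto
  finally show ?thesis using finite_card_moment_curve_hyperplane[OF assms(1), of b] by simp
qed

text \<open>The curve has no coordinate of exponent 0, so the constant coefficient is left over as
  the offset of a hyperplane.\<close>

lemma polynomial_as_functional:
  fixes q :: "real poly"
  assumes "degree q \<le> CARD('n::{finite,linorder})"
  obtains a :: "real ^ ('n::{finite,linorder})" where "\<And>t. a \<bullet> moment_curve t = poly q t - coeff q 0"
proof -
  define a :: "real ^ ('n::{finite,linorder})" where "a = (\<chi> j. coeff q (Suc (index j)))"
  have "a \<bullet> moment_curve t = poly q t - coeff q 0" for t
  proof -
    have "poly q t = (\<Sum>i\<le>CARD('n). coeff q i * t ^ i)"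
      unfolding poly_altdef using assms by (intro sum.mono_neutral_left) (auto simp: coeff_eq_0)
    also have "\<dots> = coeff q 0 + (\<Sum>i<CARD('n). coeff q (Suc i) * t ^ Suc i)"
      by (simp add: sum.atMost_shift)
    also have "(\<Sum>i<CARD('n). coeff q (Suc i) * t ^ Suc i)
             = (\<Sum>j\<in>(UNIV::'n set). coeff q (Suc (index j)) * t ^ Suc (index j))"
      using sum.reindex_bij_betw[OF bij_betw_index[where 'n = 'n], of "\<lambda>i. coeff q (Suc i) * t ^ Suc i"]
      by simp
    also have "\<dots> = a \<bullet> moment_curve t" by (simp add: inner_moment_curve a_def)
    finally show ?thesis by simp
  qed
  then show thesis by (rule that)
qed

section \<open>Faces of cyclic polytopes\<close>

context
  fixes S :: "(real ^ ('n::{finite,linorder})) set"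
  assumes S: "finite S" "S \<subseteq> range moment_curve" "CARD('n) < card S"
begin

lemma aff_dim_moment_curve_points:
  assumes "A \<subseteq> S" "CARD('n) < card A"
  shows "aff_dim A = int CARD('n)"
proof (rule ccontr)
  assume "aff_dim A \<noteq> int CARD('n)"
  then have "aff_dim A < int DIM(real ^ ('n::{finite,linorder}))" using aff_dim_le_DIM[of A] by simp
  then obtain a b where "a \<noteq> 0" "A \<subseteq> {x. a \<bullet> x = b}"
    by (rule aff_lowdim_subset_hyperplane)
  then show False using card_moment_curve_hyperplane[of a A b] assms S by auto
qed

text \<open>Enlarge A inside S to one more point than the dimension. Such a set lies in no
  hyperplane, hence is affinely independent, and so is its subset A.\<close>

lemma moment_curve_points_independent:
  assumes "A \<subseteq> S" "card A \<le> Suc CARD('n)"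
  shows "\<not> affine_dependent A"
proof -
  obtain B where B: "A \<subseteq> B" "B \<subseteq> S" "card B = Suc CARD('n)"
    using exists_subset_between[of A "Suc CARD('n)" S] assms S by auto
  then have "\<not> affine_dependent B"
    using aff_dim_moment_curve_points[of B] S(1) finite_subset
    by (auto simp: affine_independent_iff_card)
  then show ?thesis using B(1) affine_dependent_subset by blast
qed

text \<open>A proper nonempty face lies in a hyperplane, which contains at most as many points of
  the curve as the dimension; that few points of S are affinely independent.\<close>

lemma cyclic_polytope_face:
  assumes "F face_of convex hull S" "F \<noteq> convex hull S"
  obtains A where "A \<subseteq> S" "\<not> affine_dependent A" "F = convex hull A"
proof (cases "F = {}")
  case True
  then show thesis by (intro that[of "{}"]) (auto simp: affine_dependent_def)
next
  case False
  obtain A where A: "A \<subseteq> S" "F = convex hull A"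
    using face_of_convex_hull_subset[OF finite_imp_compact[OF S(1)] assms(1)] by blast
  obtain a b where "a \<noteq> 0" and ab: "F = convex hull S \<inter> {x. a \<bullet> x = b}"
    using proper_face_supporting_hyperplane[OF polyhedron_convex_hull[OF S(1)] assms False] by metis
  moreover have "A \<subseteq> {x. a \<bullet> x = b}" using A(2) ab hull_subset[of A convex] by auto
  ultimately have "card A \<le> CARD('n)" using card_moment_curve_hyperplane A(1) S(2) by blast
  then show thesis using A moment_curve_points_independent that by auto
qed

lemma simplicial_cyclic_polytope: "simplicial_polytope CARD('n) (convex hull S)"
proof -
  have dim: "aff_dim (convex hull S) = int CARD('n)"
    using aff_dim_moment_curve_points[of S] S by (simp add: aff_dim_convex_hull)
  have "\<exists>n. n simplex F" if F: "F facet_of convex hull S" for F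
  proof -
    have "F face_of convex hull S" "F \<noteq> convex hull S" using F by (auto simp: facet_of_def)
    then obtain A where "A \<subseteq> S" "\<not> affine_dependent A" "F = convex hull A"
      by (rule cyclic_polytope_face)
    then show ?thesis unfolding simplex_def
      by (intro exI[of _ "int (card A) - 1"] exI[of _ A]) auto
  qed
  then show ?thesis using dim S(1) by (auto simp: simplicial_polytope_def polytope_def)
qed

text \<open>A polynomial vanishing doubly at the parameters of \<open>A\<close> is a functional supporting
  the polytope exactly along \<open>A\<close>.\<close>

lemma cyclic_polytope_neighborly:
  assumes "A \<subseteq> S" "2 * card A \<le> CARD('n)"
  shows "convex hull A face_of convex hull S"
proof -
  obtain T where T: "A = moment_curve ` T"
    using assms(1) S(2) by (metis subset_imageE subset_trans)
  have finT: "finite T"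
    using T assms(1) S(1) finite_subset finite_imageD inj_moment_curve inj_on_subset by (metis subset_UNIV)
  have "card A = card T" using T card_image inj_moment_curve inj_on_subset by (metis subset_UNIV)
  \<comment> \<open>Squaring makes q nonnegative and gives degree at most \<open>2 * card A\<close>;
    this is the source of the bound on \<open>card A\<close>.\<close>
  define q :: "real poly" where "q = (\<Prod>t\<in>T. [:- t, 1:])\<^sup>2"
  have "degree (\<Prod>t\<in>T. [:- t, 1:]) \<le> (\<Sum>t\<in>T. 1)"
    using degree_prod_sum_le[OF finT, of "\<lambda>t. [:- t, 1:]"] by simp
  then have "degree q \<le> CARD('n)"
    using degree_power_le[of "\<Prod>t\<in>T. [:- t, 1:]" 2] assms(2) \<open>card A = card T\<close> by (simp add: q_def)
  then obtain a :: "real ^ ('n::{finite,linorder})" where a: "\<And>t. a \<bullet> moment_curve t = poly q t - coeff q 0"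
    using polynomial_as_functional by blast
  have q: "poly q t \<ge> 0" "poly q t = 0 \<longleftrightarrow> t \<in> T" for t
    using finT by (auto simp: q_def poly_prod)
  have "A \<subseteq> {x. a \<bullet> x = - coeff q 0}" using q a T by auto
  then have "affine hull A \<subseteq> {x. a \<bullet> x = - coeff q 0}"
    by (intro hull_minimal affine_hyperplane)
  moreover have "S - A \<subseteq> {x. a \<bullet> x > - coeff q 0}"
  proof
    fix x assume x: "x \<in> S - A"
    then obtain t where t: "x = moment_curve t" "t \<notin> T" using S(2) T by auto
    then show "x \<in> {x. a \<bullet> x > - coeff q 0}" using q[of t] a[of t] by auto
  qed
  then have "convex hull (S - A) \<subseteq> {x. a \<bullet> x > - coeff q 0}"
    by (intro hull_minimal convex_halfspace_gt)
  \<comment> \<open>This disjointness is the criterion for a face in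
    \<open>face_of_convex_hulls\<close>.\<close>
  ultimately have "affine hull A \<inter> convex hull (S - A) = {}" by force
  then show ?thesis by (intro face_of_convex_hulls S(1) assms(1))
qed

text \<open>In this range every j-subset of S spans a face by neighborliness, and conversely every
  face of dimension \<open>j - 1\<close> is the hull of j independent points of S.\<close>

lemma face_number_cyclic_polytope:
  assumes j: "1 \<le> j" "2 * j \<le> CARD('n)"
  shows "face_number (j - 1) (convex hull S) = card S choose j"
proof -
  let ?P = "convex hull S"
  have indep: "\<not> affine_dependent A" if "A \<subseteq> S" "card A = j" for A
    using that j by (intro moment_curve_points_independent) auto
  have "bij_betw (\<lambda>A. convex hull A) {A. A \<subseteq> S \<and> card A = j}
          {F. F face_of ?P \<and> aff_dim F = int (j - 1)}"
  proof (rule bij_betwI')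
    fix A B assume "A \<in> {A. A \<subseteq> S \<and> card A = j}" "B \<in> {A. A \<subseteq> S \<and> card A = j}"
    then have "vertices (convex hull A) = A" "vertices (convex hull B) = B"
      using indep vertices_convex_hull by blast+
    then show "convex hull A = convex hull B \<longleftrightarrow> A = B" by metis
  next
    fix A assume "A \<in> {A. A \<subseteq> S \<and> card A = j}"
    then have A: "A \<subseteq> S" "card A = j" by auto
    then show "convex hull A \<in> {F. F face_of ?P \<and> aff_dim F = int (j - 1)}"
      using cyclic_polytope_neighborly[of A] j aff_dim_affine_independent[OF indep[OF A]]
      by (simp add: aff_dim_convex_hull)
  next
    fix F assume "F \<in> {F. F face_of ?P \<and> aff_dim F = int (j - 1)}"
    then have F: "F face_of ?P" "aff_dim F = int (j - 1)" by auto
    then have "F \<noteq> ?P"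
      using j aff_dim_moment_curve_points[of S] S by (auto simp: aff_dim_convex_hull)
    with F(1) obtain A where A: "A \<subseteq> S" "\<not> affine_dependent A" "F = convex hull A"
      by (rule cyclic_polytope_face)
    then have "card A = j"
      using aff_dim_affine_independent[OF A(2)] F(2) j by (simp add: aff_dim_convex_hull)
    then show "\<exists>A\<in>{A. A \<subseteq> S \<and> card A = j}. F = convex hull A" using A by auto
  qed
  from bij_betw_same_card[OF this] show ?thesis
    using n_subsets[OF S(1)] by (simp add: face_number_def)
qed

end

lemma ex_neighborly_simplicial_polytope:
  assumes "CARD('n::{finite,linorder}) < n"
  obtains P :: "(real ^ ('n::{finite,linorder})) set" where "simplicial_polytope CARD('n::{finite,linorder}) P"
    "\<And>j. 1 \<le> j \<Longrightarrow> 2 * j \<le> CARD('n::{finite,linorder}) \<Longrightarrow> face_number (j - 1) P = n choose j"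
proof -
  define S :: "(real ^ ('n::{finite,linorder})) set" where "S = (\<lambda>i. moment_curve (real i)) ` {..<n}"
  have "inj_on (\<lambda>i. moment_curve (real i) :: real ^ ('n::{finite,linorder})) {..<n}"
    by (auto intro!: inj_onI dest: injD[OF inj_moment_curve])
  then have card: "card S = n" unfolding S_def by (simp add: card_image)
  have S: "finite S" "S \<subseteq> range moment_curve" "CARD('n) < card S"
    using assms card by (auto simp: S_def)
  show thesis
    using that[OF simplicial_cyclic_polytope[OF S]] face_number_cyclic_polytope[OF S] card by simp
qed

section \<open>Integral affine combinations of f-vectors\<close>

text \<open>The coefficients are those of the m-th finite difference at N, with signs alternating
  over row m of the Pascal triangle. That difference kills \<open>x choose j\<close> for
  \<open>j < m\<close> and takes the value 1 for \<open>j = m\<close>.\<close>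

lemma ex_binomial_dual:
  "\<exists>b :: nat \<Rightarrow> int. \<forall>j\<le>m. (\<Sum>i\<le>m. b i * int ((N + i) choose j)) = (if j = m then 1 else 0)"
proof (induction m)
  case 0
  show ?case by (intro exI[of _ "\<lambda>_. 1"]) simp
next
  case (Suc m)
  then obtain b :: "nat \<Rightarrow> int"
    where b: "\<And>j. j \<le> m \<Longrightarrow> (\<Sum>i\<le>m. b i * int ((N + i) choose j)) = (if j = m then 1 else 0)"
    by blast
  \<comment> \<open>One more difference: b shifted by one place, minus b.\<close>
  define c where "c i = (if i = 0 then 0 else b (i - 1)) - (if i \<le> m then b i else 0)" for i
  have "(\<Sum>i\<le>Suc m. c i * int ((N + i) choose j)) = (if j = Suc m then 1 else 0)" if j: "j \<le> Suc m" for j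
  proof -
    have "(\<Sum>i\<le>Suc m. c i * int ((N + i) choose j))
        = (\<Sum>i\<le>Suc m. (if i = 0 then 0 else b (i - 1)) * int ((N + i) choose j))
        - (\<Sum>i\<le>Suc m. (if i \<le> m then b i else 0) * int ((N + i) choose j))"
      by (simp only: c_def left_diff_distrib sum_subtractf)
    also have "(\<Sum>i\<le>Suc m. (if i = 0 then 0 else b (i - 1)) * int ((N + i) choose j))
             = (\<Sum>i\<le>m. b i * int (Suc (N + i) choose j))"
      by (subst sum.atMost_Suc_shift) simp
    also have "(\<Sum>i\<le>Suc m. (if i \<le> m then b i else 0) * int ((N + i) choose j))
             = (\<Sum>i\<le>m. b i * int ((N + i) choose j))"
      by simp
    also have "(\<Sum>i\<le>m. b i * int (Suc (N + i) choose j)) - (\<Sum>i\<le>m. b i * int ((N + i) choose j))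
             = (if j = Suc m then 1 else 0)"
    proof (cases j)
      case (Suc k)
      \<comment> \<open>Pascal's rule lowers j to k, where the induction hypothesis applies.\<close>
      have "(\<Sum>i\<le>m. b i * int (Suc (N + i) choose j)) - (\<Sum>i\<le>m. b i * int ((N + i) choose j))
          = (\<Sum>i\<le>m. b i * int ((N + i) choose k))"
        by (simp add: Suc algebra_simps sum.distrib)
      then show ?thesis using b[of k] j Suc by simp
    qed simp
    finally show ?thesis .
  qed
  then show ?case by blast
qed

text \<open>Adding a multiple of the dual vector of \<open>ex_binomial_dual\<close> changes only the
  top equation, and there by exactly that multiple. Hence the defect r can be repaired without
  division.\<close>

lemma ex_integer_binomial_interpolation:
  fixes z :: "nat \<Rightarrow> int"
  shows "\<exists>a. \<forall>j\<le>m. (\<Sum>i\<le>m. a i * int ((N + i) choose j)) = z j"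
proof (induction m)
  case 0
  show ?case by (intro exI[of _ "\<lambda>_. z 0"]) simp
next
  case (Suc m)
  then obtain a where a: "\<And>j. j \<le> m \<Longrightarrow> (\<Sum>i\<le>m. a i * int ((N + i) choose j)) = z j" by blast
  obtain b :: "nat \<Rightarrow> int" where b: "\<And>j. j \<le> Suc m \<Longrightarrow>
      (\<Sum>i\<le>Suc m. b i * int ((N + i) choose j)) = (if j = Suc m then 1 else 0)"
    using ex_binomial_dual by blast
  define r where "r = z (Suc m) - (\<Sum>i\<le>m. a i * int ((N + i) choose Suc m))"
  define a' where "a' i = (if i \<le> m then a i else 0) + r * b i" for i
  have "(\<Sum>i\<le>Suc m. a' i * int ((N + i) choose j)) = z j" if j: "j \<le> Suc m" for j
  proof -
    have "(\<Sum>i\<le>Suc m. a' i * int ((N + i) choose j))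
        = (\<Sum>i\<le>Suc m. (if i \<le> m then a i else 0) * int ((N + i) choose j))
        + r * (\<Sum>i\<le>Suc m. b i * int ((N + i) choose j))"
      by (simp only: a'_def distrib_right sum.distrib sum_distrib_left mult.assoc)
    also have "(\<Sum>i\<le>Suc m. (if i \<le> m then a i else 0) * int ((N + i) choose j))
             = (\<Sum>i\<le>m. a i * int ((N + i) choose j))"
      by simp
    finally show ?thesis using a[of j] b[OF j] j by (cases "j = Suc m") (auto simp: r_def)
  qed
  then show ?case by blast
qed

text \<open>The points \<open>v i\<close> may repeat, so the sum is kept over indices and evaluated
  in the direction subspace obtained by translating \<open>v 0\<close> to the origin.\<close>

lemma affine_sum_closed:
  fixes A :: "'a::real_vector set"
  assumes "affine A" "\<And>i. i < n \<Longrightarrow> v i \<in> A" "(\<Sum>i<n. a i) = 1" "(0::nat) < n"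
  shows "(\<Sum>i<n. a i *\<^sub>R v i) \<in> A"
proof -
  let ?L = "(\<lambda>x. - v 0 + x) ` A"
  have "subspace ?L" using assms by (intro affine_diffs_subspace) auto
  then have "(\<Sum>i<n. a i *\<^sub>R (- v 0 + v i)) \<in> ?L"
    using assms(2) by (intro subspace_sum subspace_scale) auto
  also have "(\<Sum>i<n. a i *\<^sub>R (- v 0 + v i)) = - v 0 + (\<Sum>i<n. a i *\<^sub>R v i)"
    using assms(3) by (simp add: algebra_simps sum_subtractf flip: scaleR_sum_left)
  finally show ?thesis by auto
qed

lemma int_affine_hull_subset_affine_hull: "int_affine_hull S \<subseteq> affine hull S"
proof
  fix x assume "x \<in> int_affine_hull S"
  then obtain n :: nat and a :: "nat \<Rightarrow> int" and v
    where x: "x = (\<Sum>i<n. of_int (a i) *\<^sub>R v i)" "n \<ge> 1" "\<forall>i<n. v i \<in> S" "(\<Sum>i<n. a i) = 1"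
    unfolding int_affine_hull_def by blast
  have "(\<Sum>i<n. real_of_int (a i)) = 1" using x(4) by (metis of_int_1 of_int_sum)
  then show "x \<in> affine hull S"
    unfolding x(1) using x by (intro affine_sum_closed) (auto intro: hull_inc)
qed

section \<open>The affine space of symmetric h-vectors and the integral affine hull\<close>

text \<open>The solutions of the Dehn-Sommerville equations, parametrized by h. Real h are allowed
  so that the set is affine and therefore bounds the real affine hull of the f-vectors from above.
  Coordinate j counts faces with \<open>Suc (index j)\<close> vertices.\<close>

definition h_vector_image :: "(real ^ ('n::{finite,linorder})) set" where
  "h_vector_image = {x. \<exists>h :: nat \<Rightarrow> real. h 0 = 1 \<and> (\<forall>k\<le>CARD('n). h (CARD('n) - k) = h k) \<and>
     (\<forall>j. x $ j = (\<Sum>k\<le>Suc (index j). h k * real ((CARD('n) - k) choose (Suc (index j) - k))))}"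

lemma affine_h_vector_image: "affine (h_vector_image :: (real ^ ('n::{finite,linorder})) set)"
  unfolding affine_def
proof (intro ballI allI impI)
  fix x y :: "real ^ ('n::{finite,linorder})" and u v :: real
  assume "x \<in> h_vector_image" "y \<in> h_vector_image" and uv: "u + v = 1"
  then obtain g h where
    g: "g 0 = 1" "\<forall>k\<le>CARD('n). g (CARD('n) - k) = g k"
      "\<And>j. x $ j = (\<Sum>k\<le>Suc (index j). g k * real ((CARD('n) - k) choose (Suc (index j) - k)))" and
    h: "h 0 = 1" "\<forall>k\<le>CARD('n). h (CARD('n) - k) = h k"
      "\<And>j. y $ j = (\<Sum>k\<le>Suc (index j). h k * real ((CARD('n) - k) choose (Suc (index j) - k)))"
    unfolding h_vector_image_def by blast
  have "(u *\<^sub>R x + v *\<^sub>R y) $ j = (\<Sum>k\<le>Suc (index j).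
      (u * g k + v * h k) * real ((CARD('n) - k) choose (Suc (index j) - k)))" for j
    by (simp only: vector_add_component vector_scaleR_component real_scaleR_def g(3) h(3)
        sum_distrib_left distrib_right sum.distrib mult.assoc)
  then show "u *\<^sub>R x + v *\<^sub>R y \<in> h_vector_image"
    using g(1,2) h(1,2) uv unfolding h_vector_image_def
    by (intro CollectI exI[of _ "\<lambda>k. u * g k + v * h k"]) auto
qed

lemma f_vector_in_h_vector_image:
  fixes P :: "(real ^ ('n::{finite,linorder})) set"
  assumes "simplicial_polytope CARD('n) P"
  shows "(f_vector P :: real ^ ('n::{finite,linorder})) \<in> h_vector_image"
proof -
  have "simplicial_polytope DIM(real ^ ('n::{finite,linorder})) P" using assms by simp
  then obtain h :: "nat \<Rightarrow> nat" where h: "h 0 = 1" "\<And>k. k \<le> CARD('n) \<Longrightarrow> h (CARD('n) - k) = h k"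
    "\<And>j. 1 \<le> j \<Longrightarrow> j \<le> CARD('n) \<Longrightarrow>
        face_number (j - 1) P = (\<Sum>k\<le>j. h k * ((CARD('n) - k) choose (j - k)))"
    by (rule simplicial_polytope_h_vector) simp
  have "(f_vector P :: real ^ ('n::{finite,linorder})) $ j
      = (\<Sum>k\<le>Suc (index j). real (h k) * real ((CARD('n) - k) choose (Suc (index j) - k)))" for j
    using h(3)[of "Suc (index j)"] index_less[of j] by (simp add: f_vector_def)
  then show ?thesis
    using h(1,2) unfolding h_vector_image_def by (intro CollectI exI[of _ "\<lambda>k. real (h k)"]) simp
qed

text \<open>By symmetry the first half of \<open>h\<close> determines all of it, and the first half of \<open>f\<close>
  determines the first half of \<open>h\<close> triangularly.\<close>

lemma h_vector_image_eqI:
  fixes x y :: "real ^ ('n::{finite,linorder})"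
  assumes "x \<in> h_vector_image" "y \<in> h_vector_image"
    and eq: "\<And>j. 2 * Suc (index j) \<le> CARD('n) \<Longrightarrow> x $ j = y $ j"
  shows "x = y"
proof -
  let ?m = "CARD('n) div 2"
  obtain g where
    g: "g 0 = 1" "\<And>k. k \<le> CARD('n) \<Longrightarrow> g (CARD('n) - k) = g k"
      "\<And>j. x $ j = (\<Sum>k\<le>Suc (index j). g k * real ((CARD('n) - k) choose (Suc (index j) - k)))"
    using assms(1) unfolding h_vector_image_def by blast
  obtain h where
    h: "h 0 = 1" "\<And>k. k \<le> CARD('n) \<Longrightarrow> h (CARD('n) - k) = h k"
      "\<And>j. y $ j = (\<Sum>k\<le>Suc (index j). h k * real ((CARD('n) - k) choose (Suc (index j) - k)))"
    using assms(2) unfolding h_vector_image_def by blast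
  have low: "g k = h k" if "k \<le> ?m" for k
  proof (rule binomial_triangular_cancel[where n = "?m" and d = "CARD('n)" and j = k])
    fix i assume i: "i \<le> ?m"
    show "(\<Sum>k\<le>i. g k * real ((CARD('n) - k) choose (i - k)))
        = (\<Sum>k\<le>i. h k * real ((CARD('n) - k) choose (i - k)))"
    proof (cases i)
      \<comment> \<open>The empty face is not a coordinate of the f-vector; its equation is the
        normalization of h at 0.\<close>
      case 0
      then show ?thesis using g(1) h(1) by simp
    next
      case (Suc l)
      then have "l < CARD('n)" using i by linarith
      then obtain j :: 'n where "index j = l" using ex_index by blast
      then show ?thesis using eq[of j] g(3)[of j] h(3)[of j] i Suc by simp
    qed
  qed (rule that)
  have "g k = h k" if k: "k \<le> CARD('n)" for k
  proof (cases "k \<le> ?m")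
    case False
    then have "CARD('n) - k \<le> ?m" by linarith
    then show ?thesis using low[of "CARD('n) - k"] g(2)[OF k] h(2)[OF k] by simp
  qed (rule low)
  then have "x $ j = y $ j" for j
    unfolding g(3) h(3) using index_less[of j] by (intro sum.cong) auto
  then show ?thesis by (simp add: vec_eq_iff)
qed

lemma simplicial_f_vectors_subset_h_vector_image:
  "affine hull (simplicial_f_vectors :: (real ^ ('n::{finite,linorder})) set) \<subseteq> h_vector_image"
  by (intro hull_minimal affine_h_vector_image)
     (auto simp: simplicial_f_vectors_def f_vector_in_h_vector_image)

lemma simplicial_f_vectors_integer:
  "simplicial_f_vectors \<subseteq> (integer_points :: (real ^ ('n::{finite,linorder})) set)"
  by (auto simp: simplicial_f_vectors_def integer_points_def f_vector_def)

lemma int_affine_hull_integer_points: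
  fixes S :: "(real ^ 'n) set"
  assumes "S \<subseteq> integer_points"
  shows "int_affine_hull S \<subseteq> integer_points"
proof
  fix x assume "x \<in> int_affine_hull S"
  then obtain n :: nat and a :: "nat \<Rightarrow> int" and v
    where x: "x = (\<Sum>i<n. of_int (a i) *\<^sub>R v i)" "\<forall>i<n. v i \<in> S"
    unfolding int_affine_hull_def by blast
  have "v i $ j \<in> \<int>" if "i < n" for i j
    using x(2) assms that by (auto simp: integer_points_def)
  then show "x \<in> integer_points"
    unfolding x(1) integer_points_def by (auto intro!: Ints_mult)
qed

lemma ex_int_affine_combination_prescribed:
  fixes x :: "real ^ ('n::{finite,linorder})"
  assumes x: "x \<in> integer_points"
  obtains y where "y \<in> int_affine_hull simplicial_f_vectors"
    "\<And>j. 2 * Suc (index j) \<le> CARD('n) \<Longrightarrow> x $ j = y $ j"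
proof -
  \<comment> \<open>The vertex numbers start at \<open>?N\<close>, the least number of vertices of a
    polytope of this dimension.\<close>
  let ?m = "CARD('n) div 2" and ?N = "Suc CARD('n)"
  \<comment> \<open>The value 1 at index 0 makes the interpolation equation for j = 0 say that the
    coefficients sum to 1. The floors lose nothing, since x is integral.\<close>
  define z :: "nat \<Rightarrow> int" where
    "z i = (if i = 0 then 1 else \<lfloor>x $ (inv index (i - 1))\<rfloor>)" for i
  obtain a where a: "\<And>j. j \<le> ?m \<Longrightarrow> (\<Sum>i\<le>?m. a i * int ((?N + i) choose j)) = z j"
    using ex_integer_binomial_interpolation by metis
  have "\<exists>P :: (real ^ ('n::{finite,linorder})) set. simplicial_polytope CARD('n) P \<and>
      (\<forall>j. 1 \<le> j \<longrightarrow> 2 * j \<le> CARD('n) \<longrightarrow> face_number (j - 1) P = (?N + i) choose j)" for i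
    by (rule ex_neighborly_simplicial_polytope[where n = "?N + i"]) auto
  then obtain P :: "nat \<Rightarrow> (real ^ ('n::{finite,linorder})) set" where
    P: "\<And>i. simplicial_polytope CARD('n) (P i)"
      "\<And>i j. 1 \<le> j \<Longrightarrow> 2 * j \<le> CARD('n) \<Longrightarrow> face_number (j - 1) (P i) = (?N + i) choose j"
    by metis
  define y :: "real ^ ('n::{finite,linorder})" where
    "y = (\<Sum>i<Suc ?m. of_int (a i) *\<^sub>R f_vector (P i))"
  show thesis
  proof
    have "(\<Sum>i<Suc ?m. a i) = 1" using a[of 0] by (simp add: z_def lessThan_Suc_atMost)
    moreover have "\<forall>i<Suc ?m. f_vector (P i) \<in> (simplicial_f_vectors :: (real ^ ('n::{finite,linorder})) set)"
      using P(1) by (auto simp: simplicial_f_vectors_def)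
    ultimately show "y \<in> int_affine_hull simplicial_f_vectors"
      unfolding int_affine_hull_def y_def
      by (intro CollectI exI[of _ "Suc ?m"] exI[of _ a] exI[of _ "\<lambda>i. f_vector (P i)"]) simp
    fix j :: 'n assume j: "2 * Suc (index j) \<le> CARD('n)"
    have "y $ j = (\<Sum>i\<le>?m. of_int (a i) * real (face_number (index j) (P i)))"
      by (simp add: y_def f_vector_def lessThan_Suc_atMost)
    also have "\<dots> = (\<Sum>i\<le>?m. of_int (a i) * real ((?N + i) choose Suc (index j)))"
      using P(2)[of "Suc (index j)"] j by simp
    also have "\<dots> = of_int (\<Sum>i\<le>?m. a i * int ((?N + i) choose Suc (index j)))" by simp
    also have "\<dots> = of_int (z (Suc (index j)))" 
      using a[of "Suc (index j)"] j by simp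
    also have "\<dots> = x $ j" using x by (simp add: z_def inv_f_f[OF inj_index] integer_points_def)
    finally show "x $ j = y $ j" by simp
  qed
qed

theorem theorem3p3:
  assumes "CARD('n::{finite,linorder}) \<ge> 2"
  shows "int_affine_hull (simplicial_f_vectors :: (real ^ ('n::{finite,linorder})) set)
       = dehn_sommerville \<inter> integer_points"
proof
  show "int_affine_hull (simplicial_f_vectors :: (real ^ ('n::{finite,linorder})) set)
      \<subseteq> dehn_sommerville \<inter> integer_points"
    using int_affine_hull_subset_affine_hull int_affine_hull_integer_points[OF simplicial_f_vectors_integer]
    unfolding dehn_sommerville_def by blast
  show "dehn_sommerville \<inter> integer_points
      \<subseteq> int_affine_hull (simplicial_f_vectors :: (real ^ ('n::{finite,linorder})) set)"
  proof
    fix x :: "real ^ ('n::{finite,linorder})" assume x: "x \<in> dehn_sommerville \<inter> integer_points"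
    obtain y :: "real ^ ('n::{finite,linorder})" where y: "y \<in> int_affine_hull simplicial_f_vectors"
      "\<And>j. 2 * Suc (index j) \<le> CARD('n) \<Longrightarrow> x $ j = y $ j"
      using x by (auto intro: ex_int_affine_combination_prescribed)
    \<comment> \<open>Real and integral affine combinations land in the same affine space, where
      agreement on the lower half of the coordinates forces equality.\<close>
    have "x \<in> h_vector_image" "y \<in> h_vector_image"
      using x y(1) int_affine_hull_subset_affine_hull simplicial_f_vectors_subset_h_vector_image
      unfolding dehn_sommerville_def by blast+
    then have "x = y" using y(2) by (rule h_vector_image_eqI)
    then show "x \<in> int_affine_hull simplicial_f_vectors" using y(1) by simp
  qed
qed

end
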